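(* Let $0<\alpha\le 1$, $0<p<1$, and let $M$ be a random variable with values in $\{0,1,2,\dots\}$ and probability generating function $P(s)$ such that $$\lim_{s\to1^-}\frac{1-P(s)}{(1-s)^\alpha}=\lambda>0.$$ Let $\{Y_j\}$ be a sequence of i.i.d. Bernoulli variables with parameter $b\in(0,1)$, independent of $M$, and put $X=\sum_{j=1}^{M}Y_j$. Let $\{X_i\}$ be a sequence of independent copies of $X$ and define $S_N=\sum_{i=1}^{N}X_i$, where $N$ is a geometric($p$) variable independent of $\{X_i\}$. Then $S_N$ is identically distributed as $M$ if and only if $b^\alpha=p$ and $M$ is $\mathrm{DML}(\lambda,\alpha)$.
   Context: A geometric($p$) variable has probability generating function $ps/(1-qs)$, $q=1-p$. A random variable has a discrete Mittag-Leffler distribution $\mathrm{DML}(\lambda,\alpha)$, $\lambda>0$, $0<\alpha\le1$, if its probability generating function is $[1+\lambda(1-s)^\alpha]^{-1}$. An empty sum is $0$. *)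

theory Defs
  imports "HOL-Probability.Probability"
begin

definition pgf :: "'a measure \<Rightarrow> ('a \<Rightarrow> nat) \<Rightarrow> real \<Rightarrow> real" where
  "pgf \<Omega> X s = integral\<^sup>L \<Omega> (\<lambda>\<omega>. s ^ X \<omega>)"

definition bernoulli_var :: "'a measure \<Rightarrow> ('a \<Rightarrow> nat) \<Rightarrow> real \<Rightarrow> bool" where
  "bernoulli_var \<Omega> Y b \<longleftrightarrow>
     Y \<in> measurable \<Omega> (count_space UNIV) \<and>
     distr \<Omega> (count_space UNIV) Y = measure_pmf (map_pmf of_bool (bernoulli_pmf b))"

text \<open>
  The library's \<^const>\<open>geometric_pmf\<close> counts the failures before the first success and so
  lives on {0, 1, 2, ...}. The geometric variables meant here count the trials, with values in
  {1, 2, ...} and probability generating function p s / (1 - q s), q = 1 - p; see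
  \<open>geometric_var_pgf\<close> below.
\<close>
definition geometric_var :: "'a measure \<Rightarrow> ('a \<Rightarrow> nat) \<Rightarrow> real \<Rightarrow> bool" where
  "geometric_var \<Omega> N p \<longleftrightarrow>
     N \<in> measurable \<Omega> (count_space UNIV) \<and>
     distr \<Omega> (count_space UNIV) N = measure_pmf (map_pmf Suc (geometric_pmf p))"

text \<open>
  The probability generating function is prescribed on the whole real interval of guaranteed
  convergence. At s = 1 the convention 0 powr a = 0 gives the correct value 1.
\<close>
definition discrete_mittag_leffler ::
    "'a measure \<Rightarrow> ('a \<Rightarrow> nat) \<Rightarrow> real \<Rightarrow> real \<Rightarrow> bool" where
  "discrete_mittag_leffler \<Omega> X l a \<longleftrightarrow>
     0 < l \<and> 0 < a \<and> a \<le> 1 \<and>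
     X \<in> measurable \<Omega> (count_space UNIV) \<and>
     (\<forall>s\<in>{-1..1}. pgf \<Omega> X s = inverse (1 + l * (1 - s) powr a))"

text \<open>
  A variable Z is independent of a sequence W 1, W 2, ... if the sigma-algebra of Z is
  independent of the sigma-algebra of the whole sequence, taken as one random element of the
  product space. The library's \<open>indep_var\<close> does not apply, because it requires both variables
  to have values in the same type. The two preimage families below already are sigma-algebras.
\<close>
definition indep_of_sequence :: "'a measure \<Rightarrow> ('a \<Rightarrow> nat) \<Rightarrow> (nat \<Rightarrow> 'a \<Rightarrow> nat) \<Rightarrow> bool" where
  "indep_of_sequence \<Omega> Z W \<longleftrightarrow>
     Z \<in> measurable \<Omega> (count_space UNIV) \<and>
     (\<lambda>\<omega>. \<lambda>i\<in>{1..}. W i \<omega>) \<in> measurable \<Omega> (\<Pi>\<^sub>M i\<in>{1..}. count_space UNIV) \<and>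
     prob_space.indep_set \<Omega>
       {Z -` U \<inter> space \<Omega> | U. U \<in> sets (count_space UNIV)}
       {(\<lambda>\<omega>. \<lambda>i\<in>{1..}. W i \<omega>) -` V \<inter> space \<Omega> | V. V \<in> sets (\<Pi>\<^sub>M i\<in>{1..}. count_space UNIV)}"

lemma geometric_var_pgf:
  assumes N: "geometric_var \<Omega> N p" and p: "0 < p" "p < 1" and s: "\<bar>s\<bar> \<le> 1"
  shows "pgf \<Omega> N s = p * s / (1 - (1 - p) * s)"
proof -
  have m: "N \<in> measurable \<Omega> (count_space UNIV)"
    and d: "distr \<Omega> (count_space UNIV) N = measure_pmf (map_pmf Suc (geometric_pmf p))"
    using N by (auto simp: geometric_var_def)
  have lt: "norm ((1 - p) * s) < 1"
  proof -
    have "norm ((1 - p) * s) = (1 - p) * \<bar>s\<bar>" using p by (simp add: abs_mult)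
    also have "\<dots> \<le> (1 - p) * 1" using p s by (intro mult_left_mono) auto
    also have "\<dots> < 1" using p by simp
    finally show ?thesis .
  qed
  have "pgf \<Omega> N s = integral\<^sup>L (distr \<Omega> (count_space UNIV) N) (\<lambda>n. s ^ n)"
    unfolding pgf_def by (subst integral_distr[OF m]) auto
  also have "\<dots> = measure_pmf.expectation (geometric_pmf p) (\<lambda>n. s ^ Suc n)"
    unfolding d by simp
  also have "\<dots> = integral\<^sup>L (count_space UNIV) (\<lambda>n. pmf (geometric_pmf p) n *\<^sub>R s ^ Suc n)"
    unfolding measure_pmf_eq_density[of "geometric_pmf p"]
    by (subst integral_density) auto
  also have "\<dots> = integral\<^sup>L (count_space UNIV) (\<lambda>n. (p * s) * ((1 - p) * s) ^ n)"
    using p by (intro Bochner_Integration.integral_cong)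
               (auto simp: power_mult_distrib mult_ac)
  also have "\<dots> = (p * s) * (\<Sum>n. ((1 - p) * s) ^ n)"
  proof -
    have "summable (\<lambda>n. norm (((1 - p) * s) ^ n))"
      using lt unfolding norm_power by (intro summable_geometric) simp
    then have "integrable (count_space UNIV) (\<lambda>n. ((1 - p) * s) ^ n)"
      by (simp add: integrable_count_space_nat_iff)
    then show ?thesis
      by (simp add: integral_count_space_nat)
  qed
  also have "\<dots> = p * s / (1 - (1 - p) * s)"
    using suminf_geometric[OF lt] by simp
  finally show ?thesis .
qed

end

theory Submission
  imports Defs
begin

text \<open>
  Put \<open>F u = P (1 - u)\<close>. In terms of generating functions the distributional equation says
  \<open>F u = p F(b u) / (1 - (1 - p) F(b u))\<close>, that is, \<open>1 / F u - 1 = (1 / F(b u) - 1) / p\<close>.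
  Hence \<open>h u = (1 / F u - 1) / u\<^sup>\<alpha>\<close> satisfies \<open>h u = (b\<^sup>\<alpha> / p) h(b u)\<close>, while the
  assumption on \<open>P\<close> gives \<open>h \<longlonglongrightarrow> \<lambda>\<close> at \<open>0\<close>. Iterating along \<open>b\<^sup>n u\<close> forces
  \<open>b\<^sup>\<alpha> = p\<close> and then \<open>h = \<lambda>\<close> on all of \<open>(0, 2]\<close>; no analytic continuation is needed to
  reach negative arguments of \<open>P\<close>.
\<close>

section \<open>The functional equation and its iteration towards 0\<close>

lemma tendsto_at_right_0_power_seq:
  fixes f :: "real \<Rightarrow> real"
  assumes "(f \<longlongrightarrow> l) (at_right 0)" "0 < b" "b < 1" "0 < u"
  shows "(\<lambda>n. f (b ^ n * u)) \<longlonglongrightarrow> l"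
proof (rule filterlim_compose[OF assms(1)])
  have "(\<lambda>n. b ^ n * u) \<longlonglongrightarrow> 0 * u"
    using assms by (intro tendsto_intros LIMSEQ_realpow_zero) auto
  then show "filterlim (\<lambda>n. b ^ n * u) (at_right 0) sequentially"
    using assms by (simp add: filterlim_at eventually_sequentiallyI)
qed

lemma power_mult_less_eventually:
  fixes b d u :: real
  assumes "0 < b" "b < 1" "0 < d"
  obtains n where "b ^ n * u < d"
proof -
  have "(\<lambda>n. b ^ n * u) \<longlonglongrightarrow> 0 * u"
    using assms by (intro tendsto_intros LIMSEQ_realpow_zero) auto
  then have "eventually (\<lambda>n. b ^ n * u < d) sequentially"
    using assms by (intro order_tendstoD) auto
  then show ?thesis
    using that by (auto simp: eventually_sequentially)
qed

text \<open>Passing to reciprocals is only legitimate where \<open>F\<close> does not vanish, so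
  positivity comes first: the limit makes \<open>F\<close> tend to 1 at 0, and the equation carries
  the sign outward to all of \<open>(0, K]\<close>. The bound \<open>F \<le> 1\<close> keeps the
  denominator at least \<open>p\<close>, and \<open>1 \<le> K\<close> puts the whole orbit
  \<open>b ^ n\<close> in the domain. Taking \<open>K = 2\<close> later covers all arguments
  \<open>1 - u\<close> in \<open>[-1, 1)\<close>.\<close>

lemma mittag_leffler_functional_equation:
  fixes F :: "real \<Rightarrow> real"
  assumes \<alpha>: "0 < \<alpha>" and p: "0 < p" "p < 1" and b: "0 < b" "b < 1" and K: "1 \<le> K"
    and F_le: "\<And>u. 0 \<le> u \<Longrightarrow> u \<le> K \<Longrightarrow> F u \<le> 1"
    and eq: "\<And>u. 0 < u \<Longrightarrow> u \<le> K \<Longrightarrow> F u = p * F (b * u) / (1 - (1 - p) * F (b * u))"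
    and lim: "((\<lambda>u. (1 - F u) / u powr \<alpha>) \<longlongrightarrow> l) (at_right 0)" and l: "l \<noteq> 0"
  shows "b powr \<alpha> = p" and "\<And>u. 0 < u \<Longrightarrow> u \<le> K \<Longrightarrow> F u = inverse (1 + l * u powr \<alpha>)"
proof -
  have bu: "b * u \<le> K" if "0 < u" "u \<le> K" for u
    using that b mult_left_le_one_le[of u b] by linarith
  have "((\<lambda>u. u powr \<alpha>) \<longlongrightarrow> 0) (at_right 0)"
    using \<alpha> by (intro tendsto_zero_powrI[of _ _ _ \<alpha>])
      (auto intro: tendsto_eq_intros simp: eventually_at_filter)
  \<comment> \<open>For \<open>u > 0\<close> this expression is just \<open>F u\<close>; writing it
    so exposes the quotient with known limit times a factor tending to 0.\<close>
  then have "((\<lambda>u. 1 - (1 - F u) / u powr \<alpha> * u powr \<alpha>) \<longlongrightarrow> 1 - l * 0) (at_right 0)"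
    by (intro tendsto_intros lim)
  moreover have "\<forall>\<^sub>F u in at_right 0. 1 - (1 - F u) / u powr \<alpha> * u powr \<alpha> = F u"
    by (simp add: eventually_at_filter)
  ultimately have F_lim: "(F \<longlongrightarrow> 1) (at_right 0)"
    using Lim_transform_eventually by fastforce
  then have F_pos: "eventually (\<lambda>u. 0 < F u) (at_right 0)"
    by (rule order_tendstoD) simp
  then obtain d where d: "0 < d" "\<And>u. 0 < u \<Longrightarrow> u < d \<Longrightarrow> 0 < F u"
    by (auto simp: eventually_at_right_field)
  have pos_step: "0 < F u" if "0 < u" "u \<le> K" "0 < F (b * u)" for u
  proof -
    have "(1 - p) * F (b * u) \<le> (1 - p) * 1"
      using p b that bu[of u] by (intro mult_left_mono F_le) auto
    also have "\<dots> < 1"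
      using p by simp
    finally have "0 < 1 - (1 - p) * F (b * u)"
      by simp
    then show ?thesis
      unfolding eq[OF that(1,2)] using that p by (intro divide_pos_pos mult_pos_pos)
  qed
  \<comment> \<open>The orbit of \<open>u\<close> enters the interval \<open>(0, d)\<close> after
    \<open>n\<close> steps, and \<open>pos_step\<close> brings positivity back one factor
    \<open>b\<close> at a time.\<close>
  have "0 < F u" if "0 < u" "u \<le> K" "b ^ n * u < d" for n u
    using that
  proof (induction n arbitrary: u)
    case 0
    then show ?case using d by simp
  next
    case (Suc n)
    then have "0 < F (b * u)"
      using bu[of u] b by (intro Suc.IH) (auto simp: mult_ac)
    then show ?case
      using pos_step Suc.prems by blast
  qed
  then have pos: "0 < F u" if "0 < u" "u \<le> K" for u
    using that power_mult_less_eventually[OF b d(1), of u] by metis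
  define h where "h u = (1 / F u - 1) / u powr \<alpha>" for u
  \<comment> \<open>Since \<open>1 / F u - 1 = (1 - F u) / F u\<close> and \<open>F\<close> tends to
    1, \<open>h\<close> inherits the limit \<open>l\<close>.\<close>
  have "((\<lambda>u. (1 - F u) / u powr \<alpha> / F u) \<longlongrightarrow> l / 1) (at_right 0)"
    by (intro tendsto_intros lim F_lim) simp
  moreover have "\<forall>\<^sub>F u in at_right 0. (1 - F u) / u powr \<alpha> / F u = h u"
    using F_pos by eventually_elim (simp add: h_def diff_divide_distrib)
  ultimately have h_lim: "(h \<longlongrightarrow> l) (at_right 0)"
    using Lim_transform_eventually by fastforce
  define c where "c = b powr \<alpha> / p"
  have h_eq: "h u = c * h (b * u)" if "0 < u" "u \<le> K" for u
  proof -
    have F0: "0 < F (b * u)"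
      using that b bu by (intro pos) auto
    have "1 / F u = (1 - (1 - p) * F (b * u)) / (p * F (b * u))"
      using eq[OF that] by simp
    then have "1 / F u - 1 = (1 / F (b * u) - 1) / p"
      using F0 p by (simp add: field_simps)
    then show ?thesis
      using that b p by (simp add: h_def c_def powr_mult)
  qed
  have seq: "(\<lambda>n. h (b ^ n * u)) \<longlonglongrightarrow> l" if "0 < u" for u
    using tendsto_at_right_0_power_seq[OF h_lim b that] .
  have h_pow: "h (b ^ n) = c * h (b ^ Suc n)" for n
    using h_eq[of "b ^ n"] b K power_le_one[of b n] by auto
  have h_seq: "(\<lambda>n. h (b ^ n)) \<longlonglongrightarrow> l"
    using seq[of 1] by simp
  \<comment> \<open>By \<open>h_pow\<close> this is the sequence \<open>h (b ^ n)\<close> again, so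
    its two limits \<open>l\<close> and \<open>c * l\<close> coincide, and
    \<open>l \<noteq> 0\<close> leaves only \<open>c = 1\<close>.\<close>
  then have "(\<lambda>n. c * h (b ^ Suc n)) \<longlonglongrightarrow> c * l"
    by (intro tendsto_intros) (rule LIMSEQ_Suc)
  then have "l = c * l"
    unfolding h_pow[symmetric] using h_seq by (rule LIMSEQ_unique[rotated])
  with l have c: "c = 1"
    by simp
  then show "b powr \<alpha> = p"
    using p by (simp add: c_def)
  fix u :: real assume u: "0 < u" "u \<le> K"
  \<comment> \<open>With \<open>c = 1\<close> the function \<open>h\<close> is constant on each
    orbit, so its value there equals its limit \<open>l\<close>.\<close>
  have "h (b ^ n * u) = h u" for n
  proof (induction n)
    case (Suc n)
    have "b ^ n * u \<le> 1 * u"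
      using u b by (intro mult_right_mono power_le_one) auto
    then have "b ^ n * u \<le> K"
      using u by linarith
    then have "h (b ^ n * u) = h (b * (b ^ n * u))"
      using h_eq[of "b ^ n * u"] u b c by simp
    with Suc show ?case
      by (simp only: power_Suc mult.assoc)
  qed simp
  with seq[OF u(1)] have "h u = l"
    by (simp add: LIMSEQ_const_iff)
  then have "1 / F u = 1 + l * u powr \<alpha>"
    using u by (simp add: h_def divide_eq_eq algebra_simps)
  then show "F u = inverse (1 + l * u powr \<alpha>)"
    using inverse_inverse_eq[of "F u"] by (simp only: inverse_eq_divide)
qed

section \<open>Generating functions as power series determining the distribution\<close>

text \<open>Once the coefficients below \<open>n\<close> vanish, division by \<open>x ^ n\<close>
  for \<open>x \<noteq> 0\<close> leaves a power series with sum 0 and constant term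
  \<open>a n\<close>; its limit at 0 is both.\<close>

lemma sums_zero_imp_coeff_zero:
  fixes a :: "nat \<Rightarrow> real"
  assumes "0 < r" and sums: "\<And>x. norm x < r \<Longrightarrow> (\<lambda>n. a n * x ^ n) sums 0"
  shows "a n = 0"
proof (induction n rule: less_induct)
  case (less n)
  have "(\<lambda>k. a (k + n) * x ^ k) sums 0" if x: "x \<noteq> 0" "norm x < r" for x
  proof -
    have "(\<lambda>k. a (k + n) * x ^ (k + n)) sums 0"
      using less sums[OF x(2)] sums_zero_iff_shift[of n "\<lambda>n. a n * x ^ n" 0] by simp
    then have "(\<lambda>k. a (k + n) * x ^ (k + n) * inverse (x ^ n)) sums (0 * inverse (x ^ n))"
      by (rule sums_mult2)
    then show ?thesis
      using x by (simp add: power_add field_simps)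
  qed
  then have "((\<lambda>_. 0) \<longlongrightarrow> a (0 + n)) (at (0::real))"
    using powser_limit_0_strong[of r "\<lambda>k. a (k + n)" "\<lambda>_. 0"] assms(1) by simp
  then show ?case
    by (simp add: tendsto_const_iff)
qed

context prob_space
begin

text \<open>Splitting an expectation over the events \<open>Z = n\<close>. The partial sums are the
  expectations of \<open>f\<close> over \<open>Z < n\<close>, to which dominated convergence applies
  with bound \<open>\<bar>f\<bar>\<close>. This yields both the power series of a generating
  function and the conditioning of a random sum on its number of terms.\<close>

lemma expectation_sums_partition:
  fixes Z :: "'a \<Rightarrow> nat" and f :: "'a \<Rightarrow> real"
  assumes Z[measurable]: "Z \<in> measurable M (count_space UNIV)" and f: "integrable M f"
  shows "(\<lambda>n. expectation (\<lambda>\<omega>. indicator {n} (Z \<omega>) * f \<omega>)) sums expectation f"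
proof -
  have ind[measurable]: "(\<lambda>\<omega>. indicator A (Z \<omega>) :: real) \<in> borel_measurable M" for A
    by (rule measurable_compose[OF Z]) simp
  have int: "integrable M (\<lambda>\<omega>. indicator {n} (Z \<omega>) * f \<omega>)" for n
    using f by (rule Bochner_Integration.integrable_bound) (use f in \<open>auto split: split_indicator\<close>)
  have "(\<lambda>n. expectation (\<lambda>\<omega>. indicator {..<n} (Z \<omega>) * f \<omega>)) \<longlonglongrightarrow> expectation f"
  proof (rule integral_dominated_convergence[where w = "\<lambda>\<omega>. \<bar>f \<omega>\<bar>"])
    show "AE \<omega> in M. (\<lambda>n. indicator {..<n} (Z \<omega>) * f \<omega>) \<longlonglongrightarrow> f \<omega>"
    proof (rule AE_I2, rule tendsto_eventually)
      fix \<omega>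
      show "\<forall>\<^sub>F n in sequentially. indicator {..<n} (Z \<omega>) * f \<omega> = f \<omega>"
        using eventually_gt_at_top[of "Z \<omega>"] by eventually_elim simp
    qed
  qed (use f in \<open>auto split: split_indicator\<close>)
  moreover have "expectation (\<lambda>\<omega>. indicator {..<n} (Z \<omega>) * f \<omega>) =
      (\<Sum>k<n. expectation (\<lambda>\<omega>. indicator {k} (Z \<omega>) * f \<omega>))" for n
  proof -
    have "indicator {..<n} z = (\<Sum>k<n. indicator {k} z :: real)" for z
      by (simp add: indicator_def)
    then have "expectation (\<lambda>\<omega>. indicator {..<n} (Z \<omega>) * f \<omega>) =
        expectation (\<lambda>\<omega>. \<Sum>k<n. indicator {k} (Z \<omega>) * f \<omega>)"
      by (simp only: sum_distrib_right)
    then show ?thesis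
      using int by (simp only: Bochner_Integration.integral_sum)
  qed
  ultimately show ?thesis
    by (simp add: sums_def)
qed

lemma expectation_indicator_singleton:
  assumes "Z \<in> measurable M (count_space UNIV)"
  shows "expectation (\<lambda>\<omega>. indicator {n} (Z \<omega>)) = measure (distr M (count_space UNIV) Z) {n}"
  by (subst integral_distr[symmetric, OF assms, where f = "indicator {n}"]) auto

lemma integrable_power_nat:
  fixes Z :: "'a \<Rightarrow> nat" and s :: real
  assumes [measurable]: "Z \<in> measurable M (count_space UNIV)" and "\<bar>s\<bar> \<le> 1"
  shows "integrable M (\<lambda>\<omega>. s ^ Z \<omega>)"
  by (rule integrable_const_bound[where B = 1]) (use assms in \<open>auto simp: power_abs power_le_one\<close>)

lemma pgf_sums:
  assumes [measurable]: "Z \<in> measurable M (count_space UNIV)" and "\<bar>s\<bar> \<le> 1"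
  shows "(\<lambda>n. measure (distr M (count_space UNIV) Z) {n} * s ^ n) sums pgf M Z s"
proof -
  have "(\<lambda>n. expectation (\<lambda>\<omega>. indicator {n} (Z \<omega>) * s ^ Z \<omega>)) sums pgf M Z s"
    unfolding pgf_def using assms by (intro expectation_sums_partition integrable_power_nat)
  moreover have "expectation (\<lambda>\<omega>. indicator {n} (Z \<omega>) * s ^ Z \<omega>) =
      expectation (\<lambda>\<omega>. indicator {n} (Z \<omega>) * s ^ n)" for n
    by (intro Bochner_Integration.integral_cong) (auto split: split_indicator)
  ultimately show ?thesis
    by (simp add: expectation_indicator_singleton)
qed

lemma abs_pgf_le_1:
  assumes [measurable]: "Z \<in> measurable M (count_space UNIV)" and "\<bar>s\<bar> \<le> 1"
  shows "\<bar>pgf M Z s\<bar> \<le> 1"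
proof -
  have "\<bar>pgf M Z s\<bar> \<le> expectation (\<lambda>\<omega>. \<bar>s ^ Z \<omega>\<bar>)"
    unfolding pgf_def by (rule integral_abs_bound)
  also have "\<dots> \<le> expectation (\<lambda>\<omega>. 1)"
    using assms by (intro integral_mono integrable_abs integrable_power_nat)
      (auto simp: power_abs power_le_one)
  finally show ?thesis
    by (simp add: prob_space)
qed

lemma pgf_1: "pgf M Z 1 = 1"
  by (simp add: pgf_def prob_space)

end

lemma pgf_cong_distr:
  assumes "X \<in> measurable \<Omega> (count_space UNIV)" "Y \<in> measurable \<Omega>' (count_space UNIV)"
    and eq: "distr \<Omega> (count_space UNIV) X = distr \<Omega>' (count_space UNIV) Y"
  shows "pgf \<Omega> X s = pgf \<Omega>' Y s"
proof -
  have "pgf \<Omega> X s = integral\<^sup>L (distr \<Omega> (count_space UNIV) X) (\<lambda>n. s ^ n)"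
    unfolding pgf_def by (subst integral_distr[OF assms(1)]) auto
  also have "\<dots> = pgf \<Omega>' Y s"
    unfolding pgf_def eq by (subst integral_distr[OF assms(2)]) auto
  finally show ?thesis .
qed

text \<open>The difference of the two power series vanishes on \<open>(-1, 1)\<close>, so the point
  masses agree, and these determine a measure on a countable space.\<close>

lemma distr_eqI_pgf:
  assumes "prob_space \<Omega>" "prob_space \<Omega>'"
    and X: "X \<in> measurable \<Omega> (count_space UNIV)" and Y: "Y \<in> measurable \<Omega>' (count_space UNIV)"
    and eq: "\<And>s. \<bar>s\<bar> < 1 \<Longrightarrow> pgf \<Omega> X s = pgf \<Omega>' Y s"
  shows "distr \<Omega> (count_space UNIV) X = distr \<Omega>' (count_space UNIV) Y" (is "?D = ?E")
proof (rule measure_eqI_countable[of _ UNIV])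
  interpret D: prob_space ?D
    using assms by (intro prob_space.prob_space_distr)
  interpret E: prob_space ?E
    using assms by (intro prob_space.prob_space_distr)
  fix n :: nat
  have "measure ?D {n} - measure ?E {n} = 0"
  proof (rule sums_zero_imp_coeff_zero[of 1])
    fix s :: real assume "norm s < 1"
    then show "(\<lambda>n. (measure ?D {n} - measure ?E {n}) * s ^ n) sums 0"
      using sums_diff[OF prob_space.pgf_sums[OF assms(1) X, of s] prob_space.pgf_sums[OF assms(2) Y, of s]]
      by (simp add: eq left_diff_distrib)
  qed simp
  then show "emeasure ?D {n} = emeasure ?E {n}"
    by (simp add: D.emeasure_eq_measure E.emeasure_eq_measure)
qed auto

lemma bernoulli_var_pgf:
  assumes "bernoulli_var \<Omega> Y b" "0 \<le> b" "b \<le> 1"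
  shows "pgf \<Omega> Y s = 1 - b + b * s"
proof -
  have "pgf \<Omega> Y s = integral\<^sup>L (distr \<Omega> (count_space UNIV) Y) (\<lambda>n. s ^ n)"
    unfolding pgf_def by (subst integral_distr) (use assms in \<open>auto simp: bernoulli_var_def\<close>)
  also have "\<dots> = 1 - b + b * s"
    using assms by (simp add: bernoulli_var_def)
  finally show ?thesis .
qed

section \<open>Independence from a sequence and random sums\<close>

context prob_space
begin

text \<open>Real functions of \<open>Z\<close> and of the whole sequence generate sub-sigma-algebras
  of the two independent preimage families. This makes the product rule for expectations available.
  Every \<open>f\<close> is measurable because \<open>Z\<close> takes values in a discrete
  space.\<close>

lemma indep_of_sequence_indep_var:
  assumes indep: "indep_of_sequence M Z W"
    and g[measurable]: "g \<in> measurable (\<Pi>\<^sub>M i\<in>{1..}. count_space UNIV) borel"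
  shows "indep_var borel (\<lambda>\<omega>. f (Z \<omega>) :: real) borel (\<lambda>\<omega>. g (\<lambda>i\<in>{1..}. W i \<omega>) :: real)"
proof -
  let ?W = "\<lambda>\<omega>. \<lambda>i\<in>{1..}. W i \<omega>" and ?P = "\<Pi>\<^sub>M i\<in>{1::nat..}. count_space (UNIV :: nat set)"
  have Z[measurable]: "Z \<in> measurable M (count_space UNIV)"
    and W[measurable]: "?W \<in> measurable M ?P"
    and ind: "indep_set {Z -` U \<inter> space M | U. U \<in> sets (count_space UNIV)}
        {?W -` V \<inter> space M | V. V \<in> sets ?P}"
    using indep by (auto simp: indep_of_sequence_def)
  \<comment> \<open>The preimages under \<open>T\<close> already form a sigma-algebra, so only the
    generators have to be located in it.\<close>
  have generated: "sigma_sets (space M) {(\<lambda>\<omega>. k (T \<omega>)) -` A \<inter> space M | A. A \<in> sets borel}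
      \<subseteq> {T -` U \<inter> space M | U. U \<in> sets N}"
    if T: "T \<in> measurable M N" and k: "k \<in> borel_measurable N"
    for N :: "'c measure" and T and k :: "'c \<Rightarrow> real"
  proof (rule sigma_algebra.sigma_sets_subset)
    have "T \<in> space M \<rightarrow> space N"
      using T by (auto dest: measurable_space)
    then show "sigma_algebra (space M) {T -` U \<inter> space M | U. U \<in> sets N}"
      using sets.sigma_algebra_axioms[of "vimage_algebra (space M) T N"]
      by (simp add: sets_vimage_algebra2)
    show "{(\<lambda>\<omega>. k (T \<omega>)) -` A \<inter> space M | A. A \<in> sets borel} \<subseteq> {T -` U \<inter> space M | U. U \<in> sets N}"
    proof safe
      fix A :: "real set" assume "A \<in> sets borel"
      then have "k -` A \<inter> space N \<in> sets N"
        using k by (rule measurable_sets[rotated])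
      moreover have "(\<lambda>\<omega>. k (T \<omega>)) -` A \<inter> space M = T -` (k -` A \<inter> space N) \<inter> space M"
        using T by (auto dest: measurable_space)
      ultimately show "\<exists>U. (\<lambda>\<omega>. k (T \<omega>)) -` A \<inter> space M = T -` U \<inter> space M \<and> U \<in> sets N"
        by blast
    qed
  qed
  show ?thesis
    unfolding indep_var_eq
  proof (intro conjI)
    show "indep_set (sigma_sets (space M) {(\<lambda>\<omega>. f (Z \<omega>)) -` A \<inter> space M | A. A \<in> sets borel})
        (sigma_sets (space M) {(\<lambda>\<omega>. g (?W \<omega>)) -` A \<inter> space M | A. A \<in> sets borel})"
      unfolding indep_set_def
    proof (rule indep_sets_mono_sets[OF ind[unfolded indep_set_def]])
      fix i
      show "case_bool (sigma_sets (space M) {(\<lambda>\<omega>. f (Z \<omega>)) -` A \<inter> space M | A. A \<in> sets borel})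
          (sigma_sets (space M) {(\<lambda>\<omega>. g (?W \<omega>)) -` A \<inter> space M | A. A \<in> sets borel}) i
        \<subseteq> case_bool {Z -` U \<inter> space M | U. U \<in> sets (count_space UNIV)}
          {?W -` V \<inter> space M | V. V \<in> sets ?P} i"
        using generated[OF Z, of f] generated[OF W g] by (cases i) auto
    qed
  qed measurable
qed

lemma measurable_random_sum:
  assumes [measurable]: "Z \<in> measurable M (count_space UNIV)"
    and W: "\<And>i::nat. i \<ge> 1 \<Longrightarrow> W i \<in> measurable M (count_space UNIV)"
  shows "(\<lambda>\<omega>. \<Sum>i=1..Z \<omega>. W i \<omega> :: nat) \<in> measurable M (count_space UNIV)"
proof -
  have "(\<lambda>\<omega>. \<Sum>i=1..n. W i \<omega>) \<in> measurable M (count_space UNIV)" for n :: nat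
  proof (induction n)
    case (Suc n)
    \<comment> \<open>The preceding partial sum has countably many values, so it may be frozen at a
      constant \<open>k\<close>; the random upper limit \<open>Z\<close> is handled in the same way
      below.\<close>
    have "(\<lambda>\<omega>. k + W (Suc n) \<omega>) \<in> measurable M (count_space UNIV)" for k
      by (rule measurable_compose[OF W]) auto
    then have "(\<lambda>\<omega>. (\<Sum>i=1..n. W i \<omega>) + W (Suc n) \<omega>) \<in> measurable M (count_space UNIV)"
      using Suc by (rule measurable_compose_countable)
    then show ?case
      by simp
  qed simp
  then show ?thesis
    by (rule measurable_compose_countable) simp
qed

text \<open>On the event \<open>Z = n\<close> the sum has \<open>n\<close> independent terms,
  contributing \<open>w ^ n\<close>; weighting by the point masses of \<open>Z\<close> gives the
  power series of its generating function at \<open>w\<close>.\<close>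

lemma pgf_random_sum:
  assumes indep: "indep_of_sequence M Z W" and W: "indep_vars (\<lambda>_. count_space UNIV) W {1..}"
    and pgf_W: "\<And>i. i \<ge> 1 \<Longrightarrow> pgf M (W i) s = w" and s: "\<bar>s\<bar> \<le> 1"
  shows "pgf M (\<lambda>\<omega>. \<Sum>i=1..Z \<omega>. W i \<omega>) s = pgf M Z w"
proof -
  have Z[measurable]: "Z \<in> measurable M (count_space UNIV)"
    using indep by (simp add: indep_of_sequence_def)
  have Wm: "W i \<in> measurable M (count_space UNIV)" if "i \<ge> 1" for i
    using W that by (auto simp: indep_vars_def)
  \<comment> \<open>This places \<open>w\<close> in the interval on which \<open>pgf_sums\<close>
    may be applied to \<open>Z\<close>.\<close>
  have w: "\<bar>w\<bar> \<le> 1"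
    using abs_pgf_le_1[OF Wm[of 1] s] pgf_W[of 1] by simp
  have S: "(\<lambda>\<omega>. \<Sum>i=1..n. W i \<omega>) \<in> measurable M (count_space UNIV)" for n
    using measurable_random_sum[of "\<lambda>_. n" W] Wm by simp
  have prod: "expectation (\<lambda>\<omega>. s ^ (\<Sum>i=1..n. W i \<omega>)) = w ^ n" for n
  proof -
    have "expectation (\<lambda>\<omega>. s ^ (\<Sum>i=1..n. W i \<omega>)) = expectation (\<lambda>\<omega>. \<Prod>i=1..n. s ^ W i \<omega>)"
      by (simp add: power_sum)
    also have "\<dots> = (\<Prod>i=1..n. expectation (\<lambda>\<omega>. s ^ W i \<omega>))"
    proof (rule indep_vars_lebesgue_integral)
      show "indep_vars (\<lambda>_. borel) (\<lambda>i \<omega>. s ^ W i \<omega>) {1..n}"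
        by (rule indep_vars_compose2[OF indep_vars_subset[OF W]]) auto
    qed (auto intro!: integrable_power_nat Wm s)
    also have "\<dots> = w ^ n"
      using pgf_W by (simp add: pgf_def)
    finally show ?thesis .
  qed
  have "expectation (\<lambda>\<omega>. indicator {n} (Z \<omega>) * s ^ (\<Sum>i=1..Z \<omega>. W i \<omega>)) =
      measure (distr M (count_space UNIV) Z) {n} * w ^ n" for n
  proof -
    let ?g = "\<lambda>x. s ^ (\<Sum>i=1..n. x i)"
    \<comment> \<open>The indicator allows the random upper limit to be replaced by
      \<open>n\<close>, after which the second factor depends on the sequence alone.\<close>
    have "expectation (\<lambda>\<omega>. indicator {n} (Z \<omega>) * s ^ (\<Sum>i=1..Z \<omega>. W i \<omega>)) =
        expectation (\<lambda>\<omega>. indicator {n} (Z \<omega>) * ?g (\<lambda>i\<in>{1..}. W i \<omega>))"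
      by (intro Bochner_Integration.integral_cong) (auto split: split_indicator)
    also have "\<dots> = expectation (\<lambda>\<omega>. indicator {n} (Z \<omega>)) * expectation (\<lambda>\<omega>. ?g (\<lambda>i\<in>{1..}. W i \<omega>))"
    proof (rule indep_var_lebesgue_integral)
      have "(\<lambda>x. \<Prod>i=1..n. s ^ x i) \<in> borel_measurable (\<Pi>\<^sub>M i\<in>{1..}. count_space UNIV)"
        by (intro borel_measurable_prod measurable_compose[OF measurable_component_singleton]) auto
      then show "indep_var borel (\<lambda>\<omega>. indicator {n} (Z \<omega>)) borel (\<lambda>\<omega>. ?g (\<lambda>i\<in>{1..}. W i \<omega>))"
        by (intro indep_of_sequence_indep_var[OF indep]) (simp add: power_sum)
      show "integrable M (\<lambda>\<omega>. indicator {n} (Z \<omega>) :: real)"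
        by (rule integrable_const_bound[where B = 1])
          (auto intro: measurable_compose[OF Z] split: split_indicator)
      show "integrable M (\<lambda>\<omega>. ?g (\<lambda>i\<in>{1..}. W i \<omega>))"
        using integrable_power_nat[OF S s, of n] by simp
    qed
    also have "\<dots> = measure (distr M (count_space UNIV) Z) {n} * w ^ n"
      using prod[of n] by (simp add: expectation_indicator_singleton)
    finally show ?thesis .
  qed
  moreover have "(\<lambda>n. expectation (\<lambda>\<omega>. indicator {n} (Z \<omega>) * s ^ (\<Sum>i=1..Z \<omega>. W i \<omega>)))
      sums pgf M (\<lambda>\<omega>. \<Sum>i=1..Z \<omega>. W i \<omega>) s"
    unfolding pgf_def
    by (intro expectation_sums_partition integrable_power_nat measurable_random_sum Z Wm s)
  ultimately show ?thesis
    using pgf_sums[OF Z w] sums_unique2 by fastforce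
qed

end

section \<open>The characterization by Bernoulli thinning and geometric summation\<close>

theorem theorem5p6:
  fixes A :: "'a measure" and B :: "'b measure"
    and \<alpha> p b l :: real
    and M :: "'a \<Rightarrow> nat" and Y :: "nat \<Rightarrow> 'a \<Rightarrow> nat" and X :: "'a \<Rightarrow> nat"
    and Xs :: "nat \<Rightarrow> 'b \<Rightarrow> nat" and N :: "'b \<Rightarrow> nat" and S :: "'b \<Rightarrow> nat"
  assumes "prob_space A" and "prob_space B"
    and "0 < \<alpha>" and "\<alpha> \<le> 1" and "0 < p" and "p < 1" and "0 < b" and "b < 1"
    and "M \<in> measurable A (count_space UNIV)"
    and "((\<lambda>s. (1 - pgf A M s) / (1 - s) powr \<alpha>) \<longlongrightarrow> l) (at_left 1)" and "l > 0"
    and "\<And>j. j \<ge> 1 \<Longrightarrow> bernoulli_var A (Y j) b"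
    and "prob_space.indep_vars A (\<lambda>_. count_space UNIV) Y {1..}"
    and "indep_of_sequence A M Y"
    and "\<And>\<omega>. X \<omega> = (\<Sum>j=1..M \<omega>. Y j \<omega>)"
    and "\<And>i. i \<ge> 1 \<Longrightarrow> distr B (count_space UNIV) (Xs i) = distr A (count_space UNIV) X"
    and "prob_space.indep_vars B (\<lambda>_. count_space UNIV) Xs {1..}"
    and "geometric_var B N p"
    and "indep_of_sequence B N Xs"
    and "\<And>\<omega>. S \<omega> = (\<Sum>i=1..N \<omega>. Xs i \<omega>)"
  shows "distr B (count_space UNIV) S = distr A (count_space UNIV) M \<longleftrightarrow>
         b powr \<alpha> = p \<and> discrete_mittag_leffler A M l \<alpha>"
proof -
  interpret A: prob_space A by fact
  interpret B: prob_space B by fact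
  note Mm = assms(9) and b = assms(7,8) and p = assms(5,6)
  have Ym: "Y j \<in> measurable A (count_space UNIV)" if "j \<ge> 1" for j
    using assms(12)[OF that] by (simp add: bernoulli_var_def)
  have Xsm: "Xs i \<in> measurable B (count_space UNIV)" if "i \<ge> 1" for i
    using assms(17) that by (auto simp: B.indep_vars_def)
  have X: "X = (\<lambda>\<omega>. \<Sum>j=1..M \<omega>. Y j \<omega>)" and S: "S = (\<lambda>\<omega>. \<Sum>i=1..N \<omega>. Xs i \<omega>)"
    using assms(15,20) by auto
  have Xm: "X \<in> measurable A (count_space UNIV)"
    unfolding X by (intro A.measurable_random_sum Mm Ym)
  have Sm: "S \<in> measurable B (count_space UNIV)"
    unfolding S using assms(18) by (intro B.measurable_random_sum Xsm) (auto simp: geometric_var_def)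
  let ?P = "pgf A M"
  have F_le: "?P (1 - u) \<le> 1" if "0 \<le> u" "u \<le> 2" for u
    using A.abs_pgf_le_1[OF Mm, of "1 - u"] that by linarith
  \<comment> \<open>Thinning becomes a scaling in the variable \<open>u\<close>, since
    \<open>1 - b + b * (1 - u) = 1 - b * u\<close>; the geometric sum then composes with the
    fraction. The range of \<open>u\<close> corresponds to
    \<open>\<bar>1 - u\<bar> \<le> 1\<close>.\<close>
  have pgf_S: "pgf B S (1 - u) = p * ?P (1 - b * u) / (1 - (1 - p) * ?P (1 - b * u))"
    if u: "0 \<le> u" "u \<le> 2" for u
  proof -
    have s: "\<bar>1 - u\<bar> \<le> 1"
      using u by auto
    have "pgf A (Y j) (1 - u) = 1 - b * u" if "j \<ge> 1" for j
      using bernoulli_var_pgf[OF assms(12)[OF that], of "1 - u"] b by (simp add: algebra_simps)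
    then have pgf_X: "pgf A X (1 - u) = ?P (1 - b * u)"
      unfolding X using assms(13,14) s by (intro A.pgf_random_sum)
    have "pgf B S (1 - u) = pgf B N (?P (1 - b * u))"
      unfolding S using assms(17,19) s
      by (intro B.pgf_random_sum) (auto simp: pgf_cong_distr[OF Xsm Xm assms(16)] pgf_X)
    then show ?thesis
      using geometric_var_pgf[OF assms(18) p] A.abs_pgf_le_1[OF Xm s] pgf_X by simp
  qed
  show ?thesis
  proof
    assume "distr B (count_space UNIV) S = distr A (count_space UNIV) M"
    then have eq: "?P (1 - u) = p * ?P (1 - b * u) / (1 - (1 - p) * ?P (1 - b * u))"
      if "0 \<le> u" "u \<le> 2" for u
      using pgf_S[OF that] pgf_cong_distr[OF Sm Mm] by simp
    have "filterlim (\<lambda>u::real. 1 - u) (at_left 1) (at_right 0)"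
      by (auto simp: filterlim_at eventually_at_filter intro!: tendsto_eq_intros)
    from filterlim_compose[OF assms(10) this]
    have lim: "((\<lambda>u. (1 - ?P (1 - u)) / u powr \<alpha>) \<longlongrightarrow> l) (at_right 0)"
      by simp
    note * = mittag_leffler_functional_equation[where F = "\<lambda>u. ?P (1 - u)" and K = 2,
        OF assms(3) p b _ F_le eq lim]
    \<comment> \<open>The functional equation determines \<open>?P\<close> only for
      \<open>u > 0\<close>; at \<open>s = 1\<close> both sides are 1, as
      \<open>0 powr \<alpha> = 0\<close>.\<close>
    have "?P s = inverse (1 + l * (1 - s) powr \<alpha>)" if "s \<in> {-1..1}" for s
      using *(2)[of "1 - s"] that assms(11) by (cases "s = 1") (auto simp: A.pgf_1)
    then show "b powr \<alpha> = p \<and> discrete_mittag_leffler A M l \<alpha>"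
      using *(1) assms(3,4,9,11) by (simp add: discrete_mittag_leffler_def)
  next
    assume R: "b powr \<alpha> = p \<and> discrete_mittag_leffler A M l \<alpha>"
    then have P: "?P (1 - u) = inverse (1 + l * u powr \<alpha>)" if "0 \<le> u" "u \<le> 2" for u
      using that by (auto simp: discrete_mittag_leffler_def)
    show "distr B (count_space UNIV) S = distr A (count_space UNIV) M"
    proof (rule distr_eqI_pgf[OF assms(2,1) Sm Mm])
      fix s :: real assume "\<bar>s\<bar> < 1"
      define u where "u = 1 - s"
      have u: "0 \<le> u" "u \<le> 2" and s: "s = 1 - u"
        using \<open>\<bar>s\<bar> < 1\<close> by (auto simp: u_def)
      \<comment> \<open>Because \<open>b powr \<alpha> = p\<close>, scaling \<open>u\<close> by
        \<open>b\<close> scales \<open>v\<close> by \<open>p\<close>, and the claim reduces to a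
        rational identity in \<open>p\<close> and \<open>v\<close>.\<close>
      define v where "v = l * u powr \<alpha>"
      have v: "0 \<le> v"
        using assms(11) by (simp add: v_def)
      have "b * u \<le> 2"
        using u b mult_left_le_one_le[of u b] by linarith
      then have Q: "?P (1 - b * u) = inverse (1 + p * v)"
        using P[of "b * u"] u b R by (auto simp: v_def powr_mult mult_ac)
      have x: "1 + p * v \<noteq> 0" "1 + v \<noteq> 0"
        using v p by (auto simp: add_nonneg_eq_0_iff)
      then have "1 - (1 - p) * inverse (1 + p * v) = p * (1 + v) * inverse (1 + p * v)"
        by (simp add: field_simps)
      with x p have "p * inverse (1 + p * v) / (1 - (1 - p) * inverse (1 + p * v)) = inverse (1 + v)"
        by (simp add: inverse_eq_divide)
      then show "pgf B S s = ?P s"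
        using pgf_S[OF u] P[OF u] Q by (simp add: s v_def)
    qed
  qed
qed

end
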